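(* For $n\geq 1$, the set $\mathcal{SB}(n)$ of Stern-Brocot partitions satisfies $$\mathcal{SB}(n)=\{\lambda\vdash n \ \mid \ \lambda\setminus (\lambda_1) \subseteq \mathrm{bin}(\lambda_1-1)\}.$$
   Context: $\lambda\vdash n$ means that $\lambda=(\lambda_1,\lambda_2,\ldots,\lambda_\ell)$ is a partition of $n$, i.e. a weakly decreasing sequence (equivalently, a finite multiset) of positive integers with sum $n$; so $\lambda_1$ is the largest part. $\lambda\setminus(\lambda_1)=(\lambda_2,\ldots,\lambda_\ell)$. For partitions, $\mu\subseteq\lambda$ means that each part of $\mu$ occurs in $\lambda$ with equal or greater multiplicity. For an integer $m\ge0$, $\mathrm{bin}(m)$ is the unique partition of $m$ into distinct powers of $2$ ($\mathrm{bin}(0)$ is the empty partition). $\lambda\sqcup\mu$ is the multiset union of partitions; $2\lambda$ doubles every part; both are applied elementwise to sets of partitions. The Stern-Brocot partitions are defined recursively by $\mathcal{SB}(1)=\{(1)\}$ and for $n\ge1$: $\mathcal{SB}(2n)=2\,\mathcal{SB}(n)$ and $\mathcal{SB}(2n+1)=\big(2\,\mathcal{SB}(n)\sqcup(1)\big)\cup\big(2\,\mathcal{SB}(n+1)\big)^-$, where $(2\,\mathcal{SB}(n+1))^-:=\{(\lambda_1,\lambda_2,\ldots,\lambda_\ell)\mid(\lambda_1+1,\lambda_2,\ldots,\lambda_\ell)\in 2\,\mathcal{SB}(n+1)\}$, i.e. $1$ is subtracted from the largest part of each partition in $2\,\mathcal{SB}(n+1)$. (All partitions in $\mathcal{SB}(n)$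 have distinct parts.) *)

theory Defs
  imports "HOL-Library.Multiset" "HOL-Library.Nat_Bijection"
begin

text \<open>A partition is represented by the finite multiset of its (positive) parts.\<close>

definition partitions :: "nat \<Rightarrow> nat multiset set" where
  "partitions n = {\<alpha>. (\<forall>k \<in># \<alpha>. 0 < k) \<and> sum_mset \<alpha> = n}"

abbreviation largest_part :: "nat multiset \<Rightarrow> nat" where
  "largest_part \<alpha> \<equiv> Max_mset \<alpha>"

definition remove_largest :: "nat multiset \<Rightarrow> nat multiset" where
  "remove_largest \<alpha> = \<alpha> - {#largest_part \<alpha>#}"

definition is_binary_partition :: "nat \<Rightarrow> nat multiset \<Rightarrow> bool" where
  "is_binary_partition m \<mu> \<longleftrightarrow>
     \<mu> \<in> partitions m \<and> (\<forall>k \<in># \<mu>. count \<mu> k = 1 \<and> (\<exists>i. k = 2 ^ i))"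

text \<open>The description is proper: see \<open>bin_unique\<close> below.\<close>

definition bin :: "nat \<Rightarrow> nat multiset" where
  "bin m = (THE \<mu>. is_binary_partition m \<mu>)"

definition double :: "nat multiset \<Rightarrow> nat multiset" where
  "double \<alpha> = image_mset (\<lambda>k. 2 * k) \<alpha>"

text \<open>
  \<open>dec_largest S\<close> is $S^-$, the set of all partitions
  $(\alpha_1, \alpha_2, \ldots)$ with $(\alpha_1 + 1, \alpha_2, \ldots) \in S$.
\<close>

definition dec_largest :: "nat multiset set \<Rightarrow> nat multiset set" where
  "dec_largest S = {\<alpha>. \<alpha> \<noteq> {#} \<and> (\<forall>k \<in># \<alpha>. 0 < k) \<and>
     add_mset (largest_part \<alpha> + 1) (remove_largest \<alpha>) \<in> S}"

text \<open>
  The value at 0 is a dummy; \<open>SB_even\<close> and \<open>SB_odd\<close> below restate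
  the recursion in its usual form.
\<close>

function SB :: "nat \<Rightarrow> nat multiset set" where
  "SB n =
     (if n = 0 then {}
      else if n = 1 then {{#1#}}
      else if even n then double ` SB (n div 2)
      else (\<lambda>\<alpha>. double \<alpha> + {#1#}) ` SB (n div 2)
           \<union> dec_largest (double ` SB (n div 2 + 1)))"
  by auto
termination
  by (relation "measure id") (auto elim!: oddE)

declare SB.simps [simp del]

lemma SB_1: "SB 1 = {{#1#}}"
  by (simp add: SB.simps)

lemma SB_even: "n \<ge> 1 \<Longrightarrow> SB (2 * n) = double ` SB n"
  by (subst SB.simps) auto

lemma SB_odd:
  "n \<ge> 1 \<Longrightarrow> SB (2 * n + 1) =
     (\<lambda>\<alpha>. double \<alpha> + {#1#}) ` SB n \<union> dec_largest (double ` SB (n + 1))"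
  by (subst SB.simps) auto

lemma bin_unique: "\<exists>!\<mu>. is_binary_partition m \<mu>"
proof -
  let ?M = "\<lambda>A. mset_set ((\<lambda>i. 2 ^ i :: nat) ` A)"
  have inj: "inj_on (\<lambda>i. 2 ^ i :: nat) A" for A :: "nat set"
    by (auto intro: inj_onI)
  have sum_M: "sum_mset (?M A) = set_encode A" for A
    using sum_unfold_sum_mset[of "\<lambda>x. x" "(\<lambda>i. 2 ^ i :: nat) ` A"]
    by (simp add: sum.reindex[OF inj] set_encode_def)
  have ex: "is_binary_partition m (?M (set_decode m))"
    using sum_M[of "set_decode m"]
    by (auto simp: is_binary_partition_def partitions_def)
  have "\<mu> = ?M (set_decode m)" if "is_binary_partition m \<mu>" for \<mu>
  proof -
    have \<mu>: "sum_mset \<mu> = m" "\<And>k. k \<in># \<mu> \<Longrightarrow> count \<mu> k = 1"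
      "\<And>k. k \<in># \<mu> \<Longrightarrow> \<exists>i. k = 2 ^ i"
      using that by (auto simp: is_binary_partition_def partitions_def)
    define A where "A = {i :: nat. 2 ^ i \<in># \<mu>}"
    have im: "(\<lambda>i. 2 ^ i) ` A = set_mset \<mu>"
      using \<mu>(3) by (fastforce simp: A_def)
    hence "finite A"
      using finite_imageD[OF _ inj] by (metis finite_set_mset)
    have "\<mu> = ?M A"
      by (rule multiset_eqI) (metis im \<mu>(2) count_mset_set finite_set_mset not_in_iff)
    with \<mu>(1) sum_M[of A] have "set_encode A = m" by simp
    with \<open>finite A\<close> have "set_decode m = A" by auto
    with \<open>\<mu> = ?M A\<close> show ?thesis by simp
  qed
  with ex show ?thesis by blast
qed

end

theory Submission
  imports Defs
begin

text \<open>
  A partition on the right-hand side consists of a largest part \<open>Suc m\<close> and a tail, namely a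
  sub-multiset of \<open>bin m\<close>; it is called \<^emph>\<open>binary-tailed\<close> below. The proof shows that the
  binary-tailed partitions satisfy the recursion that defines \<open>SB\<close>, because doubling acts
  on binary expansions in a simple way: \<open>bin (2 * m) = double (bin m)\<close> (lemma \<open>bin_even\<close>) and
  \<open>bin (Suc (2 * m)) = add_mset 1 (double (bin m))\<close> (lemma \<open>bin_odd\<close>).

  Consequently every tail is the double of a sub-multiset \<open>\<nu>\<close> of some \<open>bin m\<close>, possibly with an
  extra part \<open>1\<close>, and the extra \<open>1\<close> can only occur when the largest part is even. This leaves
  three kinds of binary-tailed partitions (lemma \<open>binary_tailed_cases\<close>), and each arises
  from the binary-tailed partition with largest part \<open>Suc m\<close> and tail \<open>\<nu>\<close> by one of
  the three operations in the Stern-Brocot recursion: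

    \<^item> largest part \<open>2 * Suc m\<close> and no part \<open>1\<close> in the tail: doubling;
    \<^item> largest part \<open>2 * Suc m\<close> and a part \<open>1\<close> in the tail: doubling and adjoining \<open>1\<close>;
    \<^item> largest part \<open>2 * Suc m - 1\<close>: doubling and decreasing the largest part.

  The first kind has even size and the other two have odd size, which matches the two
  recursion equations (lemmas \<open>binary_tailed_even\<close> and \<open>binary_tailed_odd\<close>). The only
  partition of \<open>1\<close> is binary-tailed, so strong induction on the size identifies the two
  families.
\<close>

section \<open>Binary expansions under doubling\<close>

lemma is_binary_partition_bin: "is_binary_partition m (bin m)"
  unfolding bin_def by (rule theI'[OF bin_unique])

lemma bin_eqI: "is_binary_partition m \<mu> \<Longrightarrow> bin m = \<mu>"
  using bin_unique is_binary_partition_bin by blast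

lemma bin_0: "bin 0 = {#}"
  by (rule bin_eqI) (simp add: is_binary_partition_def partitions_def)

lemma bin_part_pos: "k \<in># bin m \<Longrightarrow> 0 < k"
  using is_binary_partition_bin[of m] by (auto simp: is_binary_partition_def partitions_def)

lemma bin_part_le: "k \<in># bin m \<Longrightarrow> k \<le> m"
  using is_binary_partition_bin[of m]
  by (auto simp: is_binary_partition_def partitions_def dest: multi_member_split)

lemma sum_mset_double: "sum_mset (double \<alpha>) = 2 * sum_mset \<alpha>"
  by (induction \<alpha>) (auto simp: double_def)

lemma double_add_mset: "double (add_mset k \<alpha>) = add_mset (2 * k) (double \<alpha>)"
  by (simp add: double_def)

lemma in_double_iff: "k \<in># double \<alpha> \<longleftrightarrow> (\<exists>j \<in># \<alpha>. k = 2 * j)"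
  by (auto simp: double_def)

lemma one_notin_double: "1 \<notin># double \<alpha>"
  by (auto simp: in_double_iff)

lemma count_double: "count (double \<alpha>) (2 * k) = count \<alpha> k"
  by (induction \<alpha>) (auto simp: double_def)

lemma bin_even: "bin (2 * m) = double (bin m)"
proof (rule bin_eqI)
  have "\<exists>i. k = 2 ^ i \<and> count (bin m) k = 1" if "k \<in># bin m" for k
    using is_binary_partition_bin[of m] that by (auto simp: is_binary_partition_def)
  hence "count (double (bin m)) k = 1 \<and> (\<exists>i. k = 2 ^ i)" if "k \<in># double (bin m)" for k
    using that by (metis in_double_iff count_double power_Suc)
  moreover have "sum_mset (bin m) = m"
    using is_binary_partition_bin[of m] by (simp add: is_binary_partition_def partitions_def)
  moreover have "\<forall>k \<in># double (bin m). 0 < k"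
    using bin_part_pos by (auto simp: in_double_iff)
  ultimately show "is_binary_partition (2 * m) (double (bin m))"
    by (simp add: is_binary_partition_def partitions_def sum_mset_double)
qed

lemma bin_odd: "bin (Suc (2 * m)) = add_mset 1 (double (bin m))"
proof (rule bin_eqI)
  have "is_binary_partition (2 * m) (double (bin m))"
    using is_binary_partition_bin[of "2 * m"] by (simp add: bin_even)
  moreover have "\<exists>i. Suc 0 = 2 ^ i" by (rule exI[of _ 0]) simp
  ultimately show "is_binary_partition (Suc (2 * m)) (add_mset 1 (double (bin m)))"
    using one_notin_double[of "bin m"]
    unfolding is_binary_partition_def partitions_def
    by (auto simp: not_in_iff)
qed

lemma subset_doubleE:
  assumes "\<mu> \<subseteq># double \<alpha>"
  obtains \<nu> where "\<nu> \<subseteq># \<alpha>" "\<mu> = double \<nu>"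
proof -
  obtain \<rho> where "image_mset ((*) 2) \<alpha> = \<mu> + \<rho>"
    using assms by (auto simp: double_def mset_subset_eq_exists_conv)
  then obtain \<nu> \<sigma> where "\<alpha> = \<nu> + \<sigma>" "image_mset ((*) 2) \<nu> = \<mu>"
    by (auto dest!: image_mset_eq_plusD)
  thus thesis by (intro that[of \<nu>]) (auto simp: double_def)
qed

lemma double_mono: "\<nu> \<subseteq># \<alpha> \<Longrightarrow> double \<nu> \<subseteq># double \<alpha>"
  unfolding double_def by (rule image_mset_subseteq_mono)

section \<open>Binary-tailed partitions\<close>

text \<open>
  Parametrising by \<open>m\<close>, one less than the largest part, avoids truncated subtraction and
  matches the argument of \<open>bin\<close>.
\<close>

definition binary_tailed :: "nat \<Rightarrow> nat multiset set" where
  "binary_tailed n =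
     {add_mset (Suc m) \<mu> | m \<mu>. \<mu> \<subseteq># bin m \<and> Suc m + sum_mset \<mu> = n}"

lemma binary_tailedI:
  "\<mu> \<subseteq># bin m \<Longrightarrow> Suc m + sum_mset \<mu> = n \<Longrightarrow> add_mset (Suc m) \<mu> \<in> binary_tailed n"
  by (auto simp: binary_tailed_def)

lemma largest_part_add_mset:
  assumes "\<And>k. k \<in># \<mu> \<Longrightarrow> k \<le> a"
  shows "largest_part (add_mset a \<mu>) = a"
  using assms by (intro Max_eqI) auto

lemma remove_largest_add_mset:
  assumes "\<And>k. k \<in># \<mu> \<Longrightarrow> k \<le> a"
  shows "remove_largest (add_mset a \<mu>) = \<mu>"
  unfolding remove_largest_def by (subst largest_part_add_mset) (use assms in auto)

lemma add_largest_remove_largest: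
  "\<alpha> \<noteq> {#} \<Longrightarrow> add_mset (largest_part \<alpha>) (remove_largest \<alpha>) = \<alpha>"
  by (simp add: remove_largest_def)

lemma subset_bin_part_le: "\<mu> \<subseteq># bin m \<Longrightarrow> k \<in># \<mu> \<Longrightarrow> k \<le> m"
  by (rule bin_part_le) (rule mset_subset_eqD)

text \<open>
  The parts of \<open>bin m\<close> are at most \<open>m\<close>, so the distinguished part \<open>Suc m\<close> is recovered from
  the multiset as its maximum.
\<close>

lemma binary_tailed_eq:
  assumes "n \<ge> 1"
  shows "binary_tailed n =
    {\<alpha> \<in> partitions n. remove_largest \<alpha> \<subseteq># bin (largest_part \<alpha> - 1)}" (is "_ = ?R")
proof (intro equalityI subsetI)
  fix \<alpha> assume "\<alpha> \<in> binary_tailed n"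
  then obtain m \<mu> where \<alpha>: "\<alpha> = add_mset (Suc m) \<mu>" "\<mu> \<subseteq># bin m" "Suc m + sum_mset \<mu> = n"
    by (auto simp: binary_tailed_def)
  have le: "k \<le> Suc m" if "k \<in># \<mu>" for k
    using subset_bin_part_le[OF \<alpha>(2) that] by simp
  have "\<forall>k \<in># \<alpha>. 0 < k"
    using \<alpha> bin_part_pos by (auto dest: mset_subset_eqD)
  thus "\<alpha> \<in> ?R"
    using \<alpha>(2,3) unfolding \<alpha>(1)
    by (simp add: partitions_def largest_part_add_mset[OF le] remove_largest_add_mset[OF le]
      del: set_mset_add_mset_insert)
next
  fix \<alpha> assume \<alpha>: "\<alpha> \<in> ?R"
  hence "\<alpha> \<noteq> {#}" using assms by (auto simp: partitions_def)
  note eq = add_largest_remove_largest[OF this]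
  have "0 < largest_part \<alpha>"
    using \<alpha> \<open>\<alpha> \<noteq> {#}\<close> by (auto simp: partitions_def)
  then obtain m where m: "largest_part \<alpha> = Suc m" using gr0_implies_Suc by blast
  have "Suc m + sum_mset (remove_largest \<alpha>) = n"
    using arg_cong[OF eq, of sum_mset] \<alpha> m by (simp add: partitions_def)
  hence "add_mset (Suc m) (remove_largest \<alpha>) \<in> binary_tailed n"
    using \<alpha> m by (intro binary_tailedI) auto
  thus "\<alpha> \<in> binary_tailed n" using eq m by simp
qed

text \<open>
  The parity of the largest part decides which of \<open>bin_even\<close> and \<open>bin_odd\<close> describes the
  expansion containing the tail. An odd largest part forces an even tail (third case); for an
  even one, the part \<open>1\<close> of the expansion may be missing from the tail (first case) or present
  (second case). The stated sizes let the parity of \<open>n\<close> exclude cases later on.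
\<close>

lemma binary_tailed_cases:
  assumes "\<alpha> \<in> binary_tailed n"
  obtains
    (double) m \<nu> where "\<nu> \<subseteq># bin m" "n = 2 * (Suc m + sum_mset \<nu>)"
      "\<alpha> = double (add_mset (Suc m) \<nu>)"
  | (double_one) m \<nu> where "\<nu> \<subseteq># bin m" "n = 2 * (Suc m + sum_mset \<nu>) + 1"
      "\<alpha> = double (add_mset (Suc m) \<nu>) + {#1#}"
  | (decreased) m \<nu> where "\<nu> \<subseteq># bin m" "n + 1 = 2 * (Suc m + sum_mset \<nu>)"
      "\<alpha> = add_mset (Suc (2 * m)) (double \<nu>)"
proof -
  obtain m' \<mu> where \<alpha>: "\<alpha> = add_mset (Suc m') \<mu>" "\<mu> \<subseteq># bin m'" "Suc m' + sum_mset \<mu> = n"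
    using assms by (auto simp: binary_tailed_def)
  show thesis
  proof (cases "even m'")
    case True
    then obtain m where m: "m' = 2 * m" by blast
    then obtain \<nu> where "\<nu> \<subseteq># bin m" "\<mu> = double \<nu>"
      using \<alpha>(2) by (auto simp: bin_even elim: subset_doubleE)
    thus thesis using \<alpha> m by (intro decreased) (auto simp: sum_mset_double)
  next
    case False
    then obtain m where m: "m' = Suc (2 * m)" by (auto elim: oddE)
    hence sub: "\<mu> \<subseteq># add_mset 1 (double (bin m))" using \<alpha>(2) by (simp add: bin_odd)
    show thesis
    proof (cases "1 \<in># \<mu>")
      case True
      then obtain \<mu>' where \<mu>': "\<mu> = add_mset 1 \<mu>'" by (blast dest: multi_member_split)
      then obtain \<nu> where "\<nu> \<subseteq># bin m" "\<mu>' = double \<nu>"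
        using sub by (auto elim: subset_doubleE)
      thus thesis using \<alpha> m \<mu>'
        by (intro double_one[of \<nu> m]) (auto simp: sum_mset_double double_add_mset)
    next
      case False
      hence "\<mu> \<subseteq># double (bin m)"
        using sub subset_eq_diff_conv[of \<mu> "{#1#}" "double (bin m)"]
        by (simp add: diff_single_trivial)
      then obtain \<nu> where "\<nu> \<subseteq># bin m" "\<mu> = double \<nu>" by (rule subset_doubleE)
      thus thesis using \<alpha> m
        by (intro double[of \<nu> m]) (auto simp: sum_mset_double double_add_mset)
    qed
  qed
qed

section \<open>The Stern-Brocot recursion for binary-tailed partitions\<close>

lemma binary_tailed_1: "binary_tailed 1 = {{#1#}}"
  by (auto simp: binary_tailed_def bin_0)

lemma double_in_binary_tailed:
  assumes "\<alpha> \<in> binary_tailed n"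
  shows "double \<alpha> \<in> binary_tailed (2 * n)" "double \<alpha> + {#1#} \<in> binary_tailed (2 * n + 1)"
proof -
  obtain m \<nu> where \<alpha>: "\<alpha> = add_mset (Suc m) \<nu>" "\<nu> \<subseteq># bin m" "Suc m + sum_mset \<nu> = n"
    using assms by (auto simp: binary_tailed_def)
  have sub: "double \<nu> \<subseteq># double (bin m)" using \<alpha>(2) by (rule double_mono)
  have "add_mset (Suc (Suc (2 * m))) (double \<nu>) \<in> binary_tailed (2 * n)"
    using subset_mset.order_trans[OF sub, of "add_mset 1 (double (bin m))"] \<alpha>(3)
    by (intro binary_tailedI) (auto simp: bin_odd sum_mset_double)
  thus "double \<alpha> \<in> binary_tailed (2 * n)" by (simp add: \<alpha>(1) double_add_mset)
  have "add_mset (Suc (Suc (2 * m))) (add_mset 1 (double \<nu>)) \<in> binary_tailed (2 * n + 1)"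
    using sub \<alpha>(3) by (intro binary_tailedI) (auto simp: bin_odd sum_mset_double)
  thus "double \<alpha> + {#1#} \<in> binary_tailed (2 * n + 1)"
    by (simp add: \<alpha>(1) double_add_mset add_mset_commute)
qed

lemma binary_tailed_even: "binary_tailed (2 * n) = double ` binary_tailed n"
proof (intro equalityI subsetI)
  fix \<alpha> assume "\<alpha> \<in> binary_tailed (2 * n)"
  thus "\<alpha> \<in> double ` binary_tailed n"
  proof (cases rule: binary_tailed_cases)
    case (double m \<nu>)
    thus ?thesis by (auto intro!: imageI binary_tailedI)
  qed presburger+
qed (auto intro: double_in_binary_tailed)

text \<open>
  The parts of \<open>double \<nu>\<close> are at most \<open>2 * m\<close>, so the largest part \<open>2 * Suc m\<close> of the doubled
  partition remains the largest one after it is decreased to \<open>Suc (2 * m)\<close>. Conversely, a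
  largest part that is increased stays largest, so comparing maxima shows that no other
  partition is sent to this doubled one.
\<close>

lemma dec_largest_double_binary_tailed:
  "dec_largest (double ` binary_tailed n) =
     {add_mset (Suc (2 * m)) (double \<nu>) | m \<nu>. \<nu> \<subseteq># bin m \<and> Suc m + sum_mset \<nu> = n}"
  (is "_ = ?R")
proof (intro equalityI subsetI)
  fix \<alpha> assume "\<alpha> \<in> dec_largest (double ` binary_tailed n)"
  then obtain m \<nu> where ne: "\<alpha> \<noteq> {#}" and \<nu>: "\<nu> \<subseteq># bin m" "Suc m + sum_mset \<nu> = n"
    and eq: "add_mset (largest_part \<alpha> + 1) (remove_largest \<alpha>) =
      add_mset (2 * Suc m) (double \<nu>)" (is "?l = ?r")
    by (auto simp: dec_largest_def binary_tailed_def double_add_mset)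
  \<comment> \<open>Both multisets in \<open>eq\<close> are written with a greatest element in front, so the fronts agree.\<close>
  have le_l: "k \<le> largest_part \<alpha> + 1" if "k \<in># remove_largest \<alpha>" for k
  proof -
    have "k \<in># \<alpha>" using that by (auto simp: remove_largest_def dest: in_diffD)
    thus ?thesis by (simp add: le_SucI)
  qed
  have le_r: "k \<le> 2 * Suc m" if "k \<in># double \<nu>" for k
    using that subset_bin_part_le[OF \<nu>(1)] by (force simp: in_double_iff)
  have "largest_part \<alpha> + 1 = 2 * Suc m"
    using largest_part_add_mset[OF le_l] largest_part_add_mset[OF le_r] eq by metis
  moreover from this have "remove_largest \<alpha> = double \<nu>"
    using eq by simp
  ultimately have "\<alpha> = add_mset (Suc (2 * m)) (double \<nu>)"
    using add_largest_remove_largest[OF ne] by simp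
  thus "\<alpha> \<in> ?R" using \<nu> by blast
next
  fix \<alpha> assume "\<alpha> \<in> ?R"
  then obtain m \<nu> where \<alpha>: "\<alpha> = add_mset (Suc (2 * m)) (double \<nu>)"
    and \<nu>: "\<nu> \<subseteq># bin m" "Suc m + sum_mset \<nu> = n" by blast
  have le: "k \<le> Suc (2 * m)" if "k \<in># double \<nu>" for k
    using that subset_bin_part_le[OF \<nu>(1)] by (force simp: in_double_iff)
  have pos: "\<forall>k \<in># \<alpha>. 0 < k"
    using \<alpha> \<nu>(1) bin_part_pos by (auto simp: in_double_iff dest: mset_subset_eqD)
  have "largest_part \<alpha> = Suc (2 * m)"
    unfolding \<alpha> using le by (rule largest_part_add_mset)
  moreover have "remove_largest \<alpha> = double \<nu>"
    unfolding \<alpha> using le by (rule remove_largest_add_mset)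
  ultimately have "add_mset (largest_part \<alpha> + 1) (remove_largest \<alpha>) =
      double (add_mset (Suc m) \<nu>)"
    by (simp add: double_add_mset)
  also have "\<dots> \<in> double ` binary_tailed n"
    using \<nu> by (intro imageI binary_tailedI)
  finally show "\<alpha> \<in> dec_largest (double ` binary_tailed n)"
    using pos \<alpha> by (simp add: dec_largest_def)
qed

lemma binary_tailed_odd:
  "binary_tailed (2 * n + 1) =
     (\<lambda>\<alpha>. double \<alpha> + {#1#}) ` binary_tailed n \<union> dec_largest (double ` binary_tailed (n + 1))"
proof (intro equalityI subsetI)
  fix \<alpha> assume "\<alpha> \<in> binary_tailed (2 * n + 1)"
  thus "\<alpha> \<in> (\<lambda>\<alpha>. double \<alpha> + {#1#}) ` binary_tailed n \<union>
      dec_largest (double ` binary_tailed (n + 1))"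
  proof (cases rule: binary_tailed_cases)
    case (double m \<nu>)
    thus ?thesis by presburger
  next
    case (double_one m \<nu>)
    hence "add_mset (Suc m) \<nu> \<in> binary_tailed n" by (intro binary_tailedI) auto
    thus ?thesis using double_one(3) by blast
  next
    case (decreased m \<nu>)
    hence "Suc m + sum_mset \<nu> = n + 1" by simp
    thus ?thesis using decreased unfolding dec_largest_double_binary_tailed by blast
  qed
next
  fix \<alpha> assume "\<alpha> \<in> (\<lambda>\<alpha>. double \<alpha> + {#1#}) ` binary_tailed n \<union>
      dec_largest (double ` binary_tailed (n + 1))"
  then consider "\<alpha> \<in> (\<lambda>\<alpha>. double \<alpha> + {#1#}) ` binary_tailed n"
    | m \<nu> where "\<alpha> = add_mset (Suc (2 * m)) (double \<nu>)" "\<nu> \<subseteq># bin m"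
        "Suc m + sum_mset \<nu> = n + 1"
    unfolding dec_largest_double_binary_tailed by blast
  thus "\<alpha> \<in> binary_tailed (2 * n + 1)"
  proof cases
    case 1
    thus ?thesis using double_in_binary_tailed(2) by blast
  next
    case 2
    thus ?thesis
      by (auto simp: bin_even sum_mset_double intro!: binary_tailedI double_mono)
  qed
qed

lemma SB_eq_binary_tailed: "n \<ge> 1 \<Longrightarrow> SB n = binary_tailed n"
proof (induction n rule: less_induct)
  case (less n)
  consider "n = 1" | k where "k \<ge> 1" "n = 2 * k" | k where "k \<ge> 1" "n = 2 * k + 1"
    using less.prems by (metis One_nat_def Suc_eq_plus1 evenE gr0I less_one mult_0_right
        not_less oddE plus_1_eq_Suc)
  thus ?case
  proof cases
    case 1
    thus ?thesis by (metis SB_1 binary_tailed_1)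
  next
    case (2 k)
    thus ?thesis using less.IH[of k] by (simp add: SB_even binary_tailed_even)
  next
    case (3 k)
    have "SB k = binary_tailed k" "SB (k + 1) = binary_tailed (k + 1)"
      using 3 by (auto intro!: less.IH)
    thus ?thesis using 3(1) unfolding 3(2) by (simp only: SB_odd binary_tailed_odd)
  qed
qed

theorem theorem10p4:
  fixes n :: nat
  assumes "n \<ge> 1"
  shows "SB n = {\<alpha> \<in> partitions n. remove_largest \<alpha> \<subseteq># bin (largest_part \<alpha> - 1)}"
  using SB_eq_binary_tailed[OF assms] binary_tailed_eq[OF assms] by (rule trans)

end
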